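(* Let $r$ be a complex number such that $r^2\in\mathbb{Q}\setminus\{0\}$. Then $\cos r$ is irrational, i.e. $\cos r\notin\mathbb{Q}$.
   Context: Here $\cos$ is the usual (complex) cosine function, with argument in radians. The rational number $r^2$ is allowed to be negative, in which case $r$ is purely imaginary; so $r$ is either real or purely imaginary, and $\cos r$ is real in both cases. *)

theory Defs
  imports Complex_Main
begin

end

theory Submission
  imports Defs "HOL-Analysis.Analysis"
begin

text \<open>
  This is Niven's method, with polynomial identities in place of integrals. Let \<open>q = r\<^sup>2 = a / b\<close>, let
  \<open>p = 2 m + 1\<close> be a large prime, \<open>N = 2 p - 1\<close> and \<open>P = X\<^bsup>2p\<^esup> (1 - X\<^sup>2)\<^bsup>p-1\<^esup>\<close>. The polynomial
  \<open>G = \<Sum>\<^sub>k (-1)\<^sup>k q\<^bsup>N-k\<^esup> P\<^bsup>(2k)\<^esup>\<close> satisfies \<open>G'' + q G = q\<^bsup>N+1\<^esup> P\<close>, so the function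
  \<open>G(t) cos (r (1 - t)) + G'(t) sin (r (1 - t)) / r\<close> has a small derivative on \<open>[0, 1]\<close>, and therefore
  \<open>\<bar>G(1) - G(0) cos r\<bar>\<close> grows at most like \<open>K\<^sup>p\<close>. The numbers \<open>b\<^sup>N G(0)\<close> and \<open>b\<^sup>N G(1)\<close> are integers
  divisible by \<open>(p - 1)!\<close>; the first is divisible by \<open>p!\<close> and the second is not. If \<open>cos r\<close> were
  rational, a fixed multiple of \<open>b\<^sup>N (G(1) - G(0) cos r)\<close> would be a nonzero integer multiple of
  \<open>(p - 1)!\<close>, which is too large.
\<close>

section \<open>The alternating derivative sum and its differential equation\<close>

text \<open>This is the geometric series for the inverse of \<open>D^2 + q\<close>, with
  \<open>D\<close> the derivative, truncated at \<open>k = N\<close> and multiplied by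
  \<open>q ^ Suc N\<close> so that no negative power of \<open>q\<close> occurs.\<close>

definition niven_sum :: "complex \<Rightarrow> complex poly \<Rightarrow> nat \<Rightarrow> complex poly" where
  "niven_sum q p N = (\<Sum>k\<le>N. smult ((-1) ^ k * q ^ (N - k)) ((pderiv ^^ (2 * k)) p))"

lemma niven_sum_Suc:
  "niven_sum q p (Suc N) = smult q (niven_sum q p N) + smult ((-1) ^ Suc N) ((pderiv ^^ (2 * Suc N)) p)"
proof -
  have "(\<Sum>k\<le>N. smult ((-1) ^ k * q ^ (Suc N - k)) ((pderiv ^^ (2 * k)) p))
      = smult q (niven_sum q p N)"
    unfolding niven_sum_def
    by (rule poly_eqI)
      (auto simp: coeff_sum sum_distrib_left Suc_diff_le mult_ac intro!: sum.cong)
  then show ?thesis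
    unfolding niven_sum_def by simp
qed

text \<open>The sum telescopes: passing to \<open>Suc N\<close> adds a term whose product with
  \<open>q\<close> cancels the old remainder and whose second derivative is the new one. The
  remainder vanishes once \<open>degree p < 2 * Suc N\<close>.\<close>

lemma niven_sum_ode:
  "pderiv (pderiv (niven_sum q p N)) + smult q (niven_sum q p N)
     = smult (q ^ Suc N) p + smult ((-1) ^ N) ((pderiv ^^ (2 * Suc N)) p)"
proof (induction N)
  case 0
  show ?case by (simp add: niven_sum_def numeral_2_eq_2)
next
  case (Suc N)
  have "pderiv (pderiv (niven_sum q p (Suc N))) + smult q (niven_sum q p (Suc N))
      = smult q (pderiv (pderiv (niven_sum q p N)) + smult q (niven_sum q p N))
        + smult ((-1) ^ Suc N) ((pderiv ^^ (2 * Suc (Suc N))) p)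
        + smult (q * (-1) ^ Suc N) ((pderiv ^^ (2 * Suc N)) p)"
    by (simp add: niven_sum_Suc pderiv_diff pderiv_smult smult_diff_right smult_add_right)
  also have "\<dots> = smult (q ^ Suc (Suc N)) p + smult ((-1) ^ Suc N) ((pderiv ^^ (2 * Suc (Suc N))) p)"
    unfolding Suc.IH by (simp add: smult_add_right)
  finally show ?case .
qed

section \<open>Derivatives at 0 and 1 as Taylor coefficients\<close>

lemma higher_pderiv_eq_0:
  fixes p :: "'a :: {comm_semiring_1, semiring_no_zero_divisors} poly"
  assumes "degree p < n"
  shows "(pderiv ^^ n) p = 0"
  using assms by (intro poly_eqI) (simp add: coeff_higher_pderiv coeff_eq_0)

lemma poly_higher_pderiv_0:
  "poly ((pderiv ^^ n) p) 0 = fact n * coeff p n"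
  by (simp add: poly_0_coeff_0 coeff_higher_pderiv pochhammer_fact)

lemma higher_pderiv_pcompose_shift:
  fixes c :: "'a :: idom"
  shows "(pderiv ^^ n) (pcompose p [:c, 1:]) = pcompose ((pderiv ^^ n) p) [:c, 1:]"
  by (induction n) (simp_all add: pderiv_pcompose pderiv_pCons)

lemma pcompose_power:
  fixes p :: "'a :: comm_ring_1 poly"
  shows "pcompose (p ^ n) q = pcompose p q ^ n"
  by (induction n) (simp_all add: pcompose_mult pcompose_1)

lemma poly_higher_pderiv_1:
  fixes p :: "'a :: {idom, semiring_char_0} poly"
  shows "poly ((pderiv ^^ n) p) 1 = fact n * coeff (pcompose p [:1, 1:]) n"
  using poly_higher_pderiv_0[of n "pcompose p [:1, 1:]"]
  by (simp add: higher_pderiv_pcompose_shift poly_pcompose)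

section \<open>The analytic upper bound\<close>

text \<open>\<open>C\<close> bounds the sine factor on the segment, so it depends on
  \<open>r\<close> alone; this uniformity in \<open>p\<close> and \<open>N\<close> is what lets the
  factorial win later. The degree condition removes the remainder of the differential equation, and
  evenness of \<open>p\<close> removes a boundary term at 0.\<close>

lemma niven_sum_bound:
  fixes r :: complex
  assumes r: "r \<noteq> 0"
  obtains C where "\<And>p N. \<lbrakk>\<And>j. odd j \<Longrightarrow> coeff p j = 0; degree p \<le> 2 * N;
      \<And>x::real. \<lbrakk>0 \<le> x; x \<le> 1\<rbrakk> \<Longrightarrow> norm (poly p (of_real x)) \<le> 1\<rbrakk> \<Longrightarrow>
      norm (poly (niven_sum (r\<^sup>2) p N) 1 - poly (niven_sum (r\<^sup>2) p N) 0 * cos r)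
        \<le> C * norm (r\<^sup>2) ^ Suc N"
proof -
  have "compact ((\<lambda>z. sin (r * (1 - z)) / r) ` closed_segment 0 1)"
    by (intro compact_continuous_image continuous_intros) (use r in auto)
  then obtain C where C: "\<And>z. z \<in> closed_segment 0 1 \<Longrightarrow> norm (sin (r * (1 - z)) / r) \<le> C"
    by (meson bounded_iff compact_imp_bounded imageI)
  show ?thesis
  proof (rule that[of C])
    fix p :: "complex poly" and N
    assume odd: "\<And>j. odd j \<Longrightarrow> coeff p j = 0" and deg: "degree p \<le> 2 * N"
      and bd: "\<And>x::real. \<lbrakk>0 \<le> x; x \<le> 1\<rbrakk> \<Longrightarrow> norm (poly p (of_real x)) \<le> 1"
    define G where "G = niven_sum (r\<^sup>2) p N"
    \<comment> \<open>At 1 the sine vanishes and at 0 the derivative of \<open>G\<close> does, so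
      \<open>H 1 - H 0\<close> is the quantity to be bounded.\<close>
    define H where "H = (\<lambda>z. poly G z * cos (r * (1 - z)) + poly (pderiv G) z * (sin (r * (1 - z)) / r))"
    have ode: "pderiv (pderiv G) + smult (r\<^sup>2) G = smult ((r\<^sup>2) ^ Suc N) p"
      using niven_sum_ode[of "r\<^sup>2" p N] deg
      by (simp add: G_def higher_pderiv_eq_0 del: funpow.simps)
    have ode': "poly (pderiv (pderiv G)) z + r\<^sup>2 * poly G z = (r\<^sup>2) ^ Suc N * poly p z" for z
      using arg_cong[OF ode, of "\<lambda>f. poly f z"] by simp
    have dG0: "poly (pderiv G) 0 = 0"
    proof -
      have "poly (pderiv ((pderiv ^^ (2 * k)) p)) 0 = 0" for k
        using poly_higher_pderiv_0[of "Suc (2 * k)" p] odd by simp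
      then show ?thesis
        unfolding G_def niven_sum_def
        by (simp add: higher_pderiv_sum[of 1, simplified] pderiv_smult poly_sum)
    qed
    \<comment> \<open>The two terms in \<open>pderiv G\<close> cancel, and the differential equation
      turns the rest into a multiple of \<open>p\<close>.\<close>
    have dH: "(H has_field_derivative (r\<^sup>2) ^ Suc N * poly p z * (sin (r * (1 - z)) / r)) (at z within S)"
      for z S
    proof -
      have "(H has_field_derivative poly (pderiv G) z * cos (r * (1 - z))
            + poly G z * (r * sin (r * (1 - z)))
            + (poly (pderiv (pderiv G)) z * (sin (r * (1 - z)) / r)
            - poly (pderiv G) z * cos (r * (1 - z)))) (at z within S)"
        unfolding H_def using r
        by (auto intro!: derivative_eq_intros has_field_derivative_at_within[OF poly_DERIV]
            simp: field_simps)
      also have "poly (pderiv G) z * cos (r * (1 - z))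
            + poly G z * (r * sin (r * (1 - z)))
            + (poly (pderiv (pderiv G)) z * (sin (r * (1 - z)) / r)
            - poly (pderiv G) z * cos (r * (1 - z)))
          = (poly (pderiv (pderiv G)) z + r\<^sup>2 * poly G z) * (sin (r * (1 - z)) / r)"
        using r by (simp add: field_simps power2_eq_square)
      finally show ?thesis unfolding ode' .
    qed
    have "norm (H 1 - H 0) \<le> (norm (r\<^sup>2) ^ Suc N * 1 * C) * norm (1 - 0 :: complex)"
    proof (rule field_differentiable_bound[OF convex_closed_segment dH])
      fix z :: complex assume z: "z \<in> closed_segment 0 1"
      then obtain x :: real where x: "0 \<le> x" "x \<le> 1" "z = of_real x"
        by (auto simp: in_segment scaleR_conv_of_real)
      show "norm ((r\<^sup>2) ^ Suc N * poly p z * (sin (r * (1 - z)) / r)) \<le> norm (r\<^sup>2) ^ Suc N * 1 * C"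
        unfolding norm_mult norm_power[symmetric]
        by (intro mult_mono C z) (use bd[OF x(1,2)] x(3) in auto)
    qed auto
    then show "norm (poly (niven_sum (r\<^sup>2) p N) 1 - poly (niven_sum (r\<^sup>2) p N) 0 * cos r)
        \<le> C * norm (r\<^sup>2) ^ Suc N"
      by (simp add: H_def dG0 mult.commute flip: G_def)
  qed
qed

section \<open>Complex polynomials with integer coefficients\<close>

definition int_coeffs :: "complex poly \<Rightarrow> bool" where
  "int_coeffs p \<longleftrightarrow> (\<forall>j. coeff p j \<in> \<int>)"

lemma int_coeffs_mult: "int_coeffs p \<Longrightarrow> int_coeffs q \<Longrightarrow> int_coeffs (p * q)"
  unfolding int_coeffs_def coeff_mult by (intro allI Ints_sum Ints_mult) auto

lemma int_coeffs_1: "int_coeffs 1"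
  by (auto simp: int_coeffs_def)

lemma int_coeffs_power: "int_coeffs p \<Longrightarrow> int_coeffs (p ^ n)"
  by (induction n) (auto intro: int_coeffs_mult int_coeffs_1)

lemma int_coeffs_pCons: "a \<in> \<int> \<Longrightarrow> int_coeffs p \<Longrightarrow> int_coeffs (pCons a p)"
  by (auto simp: int_coeffs_def coeff_pCons split: nat.splits)

lemma int_coeffs_0: "int_coeffs 0"
  by (auto simp: int_coeffs_def)

lemma int_coeffs_monom: "a \<in> \<int> \<Longrightarrow> int_coeffs (monom a n)"
  by (auto simp: int_coeffs_def)

lemmas int_coeffs_intros =
  int_coeffs_0 int_coeffs_1 int_coeffs_mult int_coeffs_power int_coeffs_pCons int_coeffs_monom

lemma int_coeffsE:
  assumes "int_coeffs p"
  obtains c where "\<And>j. coeff p j = of_int (c j)"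
  using assms unfolding int_coeffs_def Ints_def image_def by simp metis

section \<open>The auxiliary polynomial and its zeros at 0 and 1\<close>

text \<open>For the prime \<open>2 * m + 1\<close> the exponents are twice the prime and the prime
  minus one; using \<open>m\<close> as parameter avoids subtraction of naturals.\<close>

definition niven_poly :: "nat \<Rightarrow> complex poly" where
  "niven_poly m = monom 1 (4 * m + 2) * [:1, 0, -1:] ^ (2 * m)"

lemma int_coeffs_niven_poly: "int_coeffs (niven_poly m)"
  unfolding niven_poly_def by (intro int_coeffs_intros) auto

lemma coeff_niven_poly_low: "j < 4 * m + 2 \<Longrightarrow> coeff (niven_poly m) j = 0"
  by (simp add: niven_poly_def coeff_monom_mult)

lemma degree_niven_poly: "degree (niven_poly m) \<le> 2 * (4 * m + 1)"
proof -
  have "degree ([:1, 0, -1:] ^ (2 * m) :: complex poly) \<le> 2 * (2 * m)"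
    using degree_power_le[of "[:1, 0, -1:] :: complex poly" "2 * m"] by simp
  moreover have "degree (monom (1::complex) (4 * m + 2)) \<le> 4 * m + 2"
    by (rule degree_monom_le)
  ultimately have "degree (niven_poly m) \<le> (4 * m + 2) + 2 * (2 * m)"
    unfolding niven_poly_def by (intro order.trans[OF degree_mult_le] add_mono)
  then show ?thesis by simp
qed

text \<open>The polynomial is invariant under replacing \<open>X\<close> by
  \<open>-X\<close>.\<close>

lemma coeff_niven_poly_odd:
  assumes "odd j"
  shows "coeff (niven_poly m) j = 0"
proof -
  have "[:0, -1:] ^ (4 * m) = ([:0, 1:] ^ (4 * m) :: complex poly)"
    using uminus_power_if[of "[:0, 1:] :: complex poly" "4 * m"] by simp
  then have "pcompose (niven_poly m) (monom (-1) (Suc 0)) = niven_poly m"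
    by (simp add: niven_poly_def pcompose_mult pcompose_power monom_altdef pcompose_pCons)
  then have "(-1) ^ j * coeff (niven_poly m) j = coeff (niven_poly m) j"
    by (metis coeff_pcompose_monom_linear)
  then show ?thesis using assms by simp
qed

lemma norm_niven_poly_le:
  assumes "0 \<le> x" "x \<le> 1"
  shows "norm (poly (niven_poly m) (of_real x)) \<le> 1"
proof -
  have "poly (niven_poly m) (of_real x) = of_real (x ^ (4 * m + 2) * (1 - x * x) ^ (2 * m))"
    by (simp add: niven_poly_def poly_monom)
  moreover have "0 \<le> 1 - x * x" "1 - x * x \<le> 1"
    using assms by (auto simp: mult_le_one)
  ultimately show ?thesis
    using assms by (auto simp del: of_real_mult of_real_power simp: abs_mult power_abs intro!: mult_le_one power_le_one)
qed

text \<open>Since \<open>1 - (1 + X)^2 = X * (-2 - X)\<close>, the zero at 1 has order exactly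
  \<open>2 * m\<close>.\<close>

lemma niven_poly_shift:
  "pcompose (niven_poly m) [:1, 1:] = monom 1 (2 * m) * ([:1, 1:] ^ (4 * m + 2) * [:-2, -1:] ^ (2 * m))"
proof -
  have "pcompose (monom 1 (4 * m + 2)) [:1, 1 :: complex:] = [:1, 1:] ^ (4 * m + 2)"
    unfolding monom_altdef pcompose_smult pcompose_power by (simp add: pcompose_pCons)
  moreover have "pcompose [:1, 0, -1:] [:1, 1:] = monom 1 1 * [:-2, -1 :: complex:]"
    by (simp add: pcompose_pCons monom_altdef)
  moreover have "monom 1 (2 * m) = (monom 1 1 :: complex poly) ^ (2 * m)"
    by (simp add: monom_altdef)
  ultimately show ?thesis
    by (simp only: niven_poly_def pcompose_mult pcompose_power power_mult_distrib mult_ac)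
qed

lemma int_coeffs_niven_poly_shift: "int_coeffs (pcompose (niven_poly m) [:1, 1:])"
  unfolding niven_poly_shift by (intro int_coeffs_intros) auto

lemma coeff_niven_poly_shift_low:
  "j < 2 * m \<Longrightarrow> coeff (pcompose (niven_poly m) [:1, 1:]) j = 0"
  by (simp add: niven_poly_shift coeff_monom_mult)

text \<open>The value is \<open>(-2) ^ (2 * m)\<close>. As a power of 2 it is coprime to any odd
  prime.\<close>

lemma coeff_niven_poly_shift: "coeff (pcompose (niven_poly m) [:1, 1:]) (2 * m) = 4 ^ m"
  by (simp add: niven_poly_shift coeff_monom_mult coeff_mult_0 coeff_0_power power_mult)

section \<open>Divisibility by factorials and the lower bound\<close>

text \<open>Terms with \<open>k < m\<close> vanish, and for \<open>k > m\<close> the factor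
  \<open>fact (2 * k)\<close> already contains \<open>fact (Suc (2 * m))\<close>; only
  \<open>k = m\<close> can survive.\<close>

lemma fact_dvd_sum:
  fixes c :: "nat \<Rightarrow> int"
  assumes "m \<le> N" and low: "\<And>j. j < 2 * m \<Longrightarrow> c j = 0"
  shows "fact (Suc (2 * m)) dvd
    (\<Sum>k\<le>N. (-1) ^ k * a ^ (N - k) * b ^ k * (fact (2 * k) * c (2 * k)))
      - (-1) ^ m * a ^ (N - m) * b ^ m * (fact (2 * m) * c (2 * m))"
proof -
  have "(\<Sum>k\<le>N. (-1) ^ k * a ^ (N - k) * b ^ k * (fact (2 * k) * c (2 * k)))
      - (-1) ^ m * a ^ (N - m) * b ^ m * (fact (2 * m) * c (2 * m))
     = (\<Sum>k\<in>{..N} - {m}. (-1) ^ k * a ^ (N - k) * b ^ k * (fact (2 * k) * c (2 * k)))"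
    using \<open>m \<le> N\<close> by (subst sum.remove[of _ m]) auto
  also have "fact (Suc (2 * m)) dvd \<dots>"
  proof (rule dvd_sum)
    fix k assume k: "k \<in> {..N} - {m}"
    show "fact (Suc (2 * m)) dvd (-1) ^ k * a ^ (N - k) * b ^ k * (fact (2 * k) * c (2 * k))"
    proof (cases "k < m")
      case True
      then show ?thesis by (simp add: low)
    next
      case False
      then have "fact (Suc (2 * m)) dvd (fact (2 * k) :: int)"
        using k by (intro fact_dvd) auto
      then show ?thesis by (intro dvd_mult dvd_mult2)
    qed
  qed
  finally show ?thesis .
qed

lemma scaled_niven_sum:
  fixes c :: "nat \<Rightarrow> int"
  assumes q: "q = of_int a / of_int b" and b: "b \<noteq> 0"
    and c: "\<And>k. poly ((pderiv ^^ (2 * k)) p) x = fact (2 * k) * of_int (c (2 * k))"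
  shows "of_int b ^ N * poly (niven_sum q p N) x
    = of_int (\<Sum>k\<le>N. (-1) ^ k * a ^ (N - k) * b ^ k * (fact (2 * k) * c (2 * k)))"
proof -
  have *: "of_int b ^ N * q ^ (N - k) = of_int a ^ (N - k) * of_int b ^ k" if "k \<le> N" for k
  proof -
    have "of_int b ^ N = (of_int b ^ (N - k) * of_int b ^ k :: complex)"
      using that by (simp flip: power_add)
    then show ?thesis using b by (simp add: q power_divide)
  qed
  have "of_int b ^ N * poly (niven_sum q p N) x
      = (\<Sum>k\<le>N. (-1) ^ k * (of_int b ^ N * q ^ (N - k)) * (fact (2 * k) * of_int (c (2 * k))))"
    unfolding niven_sum_def poly_sum sum_distrib_left poly_smult c by (simp add: mult_ac)
  also have "\<dots> = (\<Sum>k\<le>N. (-1) ^ k * (of_int a ^ (N - k) * of_int b ^ k) * (fact (2 * k) * of_int (c (2 * k))))"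
    by (intro sum.cong refl) (simp add: *)
  finally show ?thesis by (simp add: mult_ac)
qed

text \<open>The scaled combination is an integer multiple of \<open>fact (2 * m)\<close>, and the
  cofactor is nonzero because it is not divisible by the prime \<open>2 * m + 1\<close>.\<close>

lemma fact_le_scaled_combination:
  fixes a b u v :: int and m :: nat
  assumes p: "prime (2 * m + 1)" and large: "2 * m + 1 > 4 * nat \<bar>a * b * v\<bar>"
    and nz: "a \<noteq> 0" "b \<noteq> 0" "v \<noteq> 0" and q: "q = of_int a / of_int b"
  defines "G \<equiv> niven_sum q (niven_poly m) (4 * m + 1)"
  shows "fact (2 * m) \<le> norm (of_int b ^ (4 * m + 1) * (of_int v * poly G 1 - of_int u * poly G 0))"
proof -
  define N where "N = 4 * m + 1"
  obtain c0 where c0: "\<And>j. coeff (niven_poly m) j = of_int (c0 j)"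
    using int_coeffsE[OF int_coeffs_niven_poly] by metis
  obtain c1 where c1: "\<And>j. coeff (pcompose (niven_poly m) [:1, 1:]) j = of_int (c1 j)"
    using int_coeffsE[OF int_coeffs_niven_poly_shift] by metis
  have c0_low: "c0 j = 0" if "j < 4 * m + 2" for j
    using coeff_niven_poly_low[OF that] c0[of j] by simp
  have c1_low: "c1 j = 0" if "j < 2 * m" for j
    using coeff_niven_poly_shift_low[OF that] c1[of j] by simp
  have c1_m: "c1 (2 * m) = 4 ^ m"
  proof -
    have "of_int (c1 (2 * m)) = (of_int (4 ^ m) :: complex)"
      using coeff_niven_poly_shift[of m] c1[of "2 * m"] by simp
    then show ?thesis unfolding of_int_eq_iff .
  qed
  define A where "A = (\<Sum>k\<le>N. (-1) ^ k * a ^ (N - k) * b ^ k * (fact (2 * k) * c1 (2 * k)))"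
  define B where "B = (\<Sum>k\<le>N. (-1) ^ k * a ^ (N - k) * b ^ k * (fact (2 * k) * c0 (2 * k)))"
  \<comment> \<open>The surviving term \<open>k = m\<close> of \<open>A\<close>, without its factor
    \<open>fact (2 * m)\<close>.\<close>
  define E where "E = (-1) ^ m * a ^ (N - m) * b ^ m * 4 ^ m"
  have A: "of_int b ^ N * poly G 1 = of_int A"
    unfolding A_def G_def N_def using q nz c1
    by (intro scaled_niven_sum) (auto simp: poly_higher_pderiv_1)
  have B: "of_int b ^ N * poly G 0 = of_int B"
    unfolding B_def G_def N_def using q nz c0
    by (intro scaled_niven_sum) (auto simp: poly_higher_pderiv_0)
  have "fact (Suc (2 * m)) dvd A - (-1) ^ m * a ^ (N - m) * b ^ m * (fact (2 * m) * c1 (2 * m))"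
    unfolding A_def by (rule fact_dvd_sum) (auto simp: N_def c1_low)
  then have dA: "fact (Suc (2 * m)) dvd A - fact (2 * m) * E"
    unfolding c1_m E_def by (simp add: mult_ac)
  have "fact (Suc (2 * m)) dvd B - (-1) ^ m * a ^ (N - m) * b ^ m * (fact (2 * m) * c0 (2 * m))"
    unfolding B_def by (rule fact_dvd_sum) (auto simp: N_def c0_low)
  \<comment> \<open>Here the term \<open>k = m\<close> is zero as well, because
    \<open>2 * m < 4 * m + 2\<close>.\<close>
  then have dB: "fact (Suc (2 * m)) dvd B"
    by (simp add: c0_low)
  define D where "D = v * A - u * B"
  have "D = v * (A - fact (2 * m) * E) - u * B + fact (2 * m) * (v * E)"
    by (simp add: D_def algebra_simps)
  moreover obtain z where "v * (A - fact (2 * m) * E) - u * B = fact (Suc (2 * m)) * z"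
    using dA dB by (metis dvdE dvd_diff dvd_mult)
  ultimately have D: "D = fact (2 * m) * (int (2 * m + 1) * z + v * E)"
    by (simp add: algebra_simps)
  have "\<not> int (2 * m + 1) dvd v * E"
  proof
    assume dvd: "int (2 * m + 1) dvd v * E"
    \<comment> \<open>The size condition on the prime excludes every factor of \<open>v * E\<close>
      at once; the instance 1 disposes of the sign \<open>(-1) ^ m\<close>.\<close>
    have small: "\<not> int (2 * m + 1) dvd w" if "w dvd 4 * (a * b * v)" for w
    proof
      assume "int (2 * m + 1) dvd w"
      then have "int (2 * m + 1) dvd 4 * (a * b * v)" using that by (rule dvd_trans)
      then have "int (2 * m + 1) \<le> \<bar>4 * (a * b * v)\<bar>"
        using nz dvd_imp_le_int[of "4 * (a * b * v)" "int (2 * m + 1)"] by simp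
      with large show False by (simp add: abs_mult)
    qed
    have prime: "prime (int (2 * m + 1))" using p by (simp only: prime_nat_int_transfer)
    show False
      using dvd small[of v] small[of a] small[of b] small[of 4] small[of 1]
      unfolding E_def
      by (auto simp only: prime_dvd_mult_iff[OF prime] dvd_mult2 dvd_mult dvd_triv_left dvd_triv_right
            dvd_refl one_dvd minus_dvd_iff dvd_minus_iff dest!: prime_dvd_power[OF prime])
  qed
  then have "int (2 * m + 1) * z + v * E \<noteq> 0"
    by (metis dvd_0_right dvd_add_right_iff dvd_triv_left)
  then have "1 \<le> \<bar>int (2 * m + 1) * z + v * E\<bar>" by linarith
  then have "fact (2 * m) * 1 \<le> fact (2 * m) * \<bar>int (2 * m + 1) * z + v * E\<bar>"
    by (intro mult_left_mono) auto
  then have "fact (2 * m) \<le> \<bar>D\<bar>"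
    unfolding D by (simp add: abs_mult del: of_nat_add of_nat_mult)
  then have "real_of_int (fact (2 * m)) \<le> real_of_int \<bar>D\<bar>"
    by (simp only: of_int_le_iff)
  also have "real_of_int \<bar>D\<bar> = norm (of_int D :: complex)" by simp
  also have "of_int D = of_int v * (of_int b ^ N * poly G 1) - of_int u * (of_int b ^ N * poly G 0)"
    by (simp add: D_def A B)
  also have "\<dots> = of_int b ^ N * (of_int v * poly G 1 - of_int u * poly G 0)"
    by (simp add: algebra_simps)
  finally show ?thesis by (simp add: N_def)
qed

section \<open>Factorial growth against exponential growth\<close>

theorem theorem3:
  fixes r :: complex
  assumes "r\<^sup>2 \<in> \<rat> - {0}"
  shows "cos r \<notin> \<rat>"
proof
  assume "cos r \<in> \<rat>"
  then obtain u v :: int where v: "v > 0" and cos: "cos r = of_int u / of_int v"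
    by (elim Rats_cases') auto
  from assms obtain a b :: int where b: "b > 0" and q: "r\<^sup>2 = of_int a / of_int b"
    by (auto elim: Rats_cases')
  from assms q have a: "a \<noteq> 0" and r: "r \<noteq> 0" by auto
  obtain C where C: "\<And>p N. \<lbrakk>\<And>j. odd j \<Longrightarrow> coeff p j = 0; degree p \<le> 2 * N;
      \<And>x::real. \<lbrakk>0 \<le> x; x \<le> 1\<rbrakk> \<Longrightarrow> norm (poly p (of_real x)) \<le> 1\<rbrakk> \<Longrightarrow>
      norm (poly (niven_sum (r\<^sup>2) p N) 1 - poly (niven_sum (r\<^sup>2) p N) 0 * cos r)
        \<le> C * norm (r\<^sup>2) ^ Suc N"
    using niven_sum_bound[OF r] by blast
  \<comment> \<open>As \<open>b * norm (r\<^sup>2)\<close> equals the absolute value of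
    \<open>a\<close>, the upper bound is exponential in \<open>2 * m\<close> with base
    \<open>x\<close>; \<open>K\<close> collects the factors free of \<open>m\<close>.\<close>
  define x K where "x = (real_of_int a)\<^sup>2" and "K = real_of_int v * C * norm (r\<^sup>2) * \<bar>real_of_int a\<bar>"
  have main: "fact (2 * m) \<le> K * x ^ (2 * m)"
    if p: "prime (2 * m + 1)" "2 * m + 1 > 4 * nat \<bar>a * b * v\<bar>" for m
  proof -
    define G where "G = niven_sum (r\<^sup>2) (niven_poly m) (4 * m + 1)"
    have "fact (2 * m) \<le> norm (of_int b ^ (4 * m + 1) * (of_int v * poly G 1 - of_int u * poly G 0))"
      unfolding G_def using p a b v q by (intro fact_le_scaled_combination) auto
    also have "of_int v * poly G 1 - of_int u * poly G 0 = of_int v * (poly G 1 - poly G 0 * cos r)"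
      using v by (simp add: cos field_simps)
    also have "norm (of_int b ^ (4 * m + 1) * \<dots>)
        = of_int b ^ (4 * m + 1) * of_int v * norm (poly G 1 - poly G 0 * cos r)"
      using b v by (simp add: norm_mult norm_power)
    also have "\<dots> \<le> of_int b ^ (4 * m + 1) * of_int v * (C * norm (r\<^sup>2) ^ Suc (4 * m + 1))"
      unfolding G_def using b v
      by (intro mult_left_mono C coeff_niven_poly_odd degree_niven_poly norm_niven_poly_le) auto
    also have "\<dots> = of_int v * C * norm (r\<^sup>2) * (of_int b * norm (r\<^sup>2)) ^ (4 * m + 1)"
      by (simp only: power_mult_distrib power_Suc mult_ac)
    also have "of_int b * norm (r\<^sup>2) = \<bar>real_of_int a\<bar>"
      using b unfolding q by (simp add: norm_divide)
    also have "of_int v * C * norm (r\<^sup>2) * \<bar>real_of_int a\<bar> ^ (4 * m + 1) = K * (\<bar>real_of_int a\<bar> ^ 2) ^ (2 * m)"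
      by (simp add: K_def power_even_abs flip: power_mult)
    finally show ?thesis by (simp add: x_def)
  qed
  have "(\<lambda>n. inverse (fact n) * x ^ n) \<longlonglongrightarrow> 0"
    by (rule summable_LIMSEQ_zero[OF summable_exp])
  then have "(\<lambda>n. K * (inverse (fact n) * x ^ n)) \<longlonglongrightarrow> K * 0"
    by (intro tendsto_mult tendsto_const)
  then have "eventually (\<lambda>n. K * (inverse (fact n) * x ^ n) < 1) sequentially"
    by (intro order_tendstoD) auto
  then obtain n0 where n0: "\<And>n. n \<ge> n0 \<Longrightarrow> K * (inverse (fact n) * x ^ n) < 1"
    by (auto simp: eventually_sequentially)
  \<comment> \<open>One bound serves three ends: \<open>p\<close> is odd,
    \<open>2 * m = p - 1\<close> is at least \<open>n0\<close>, and the size condition of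
    \<open>main\<close> holds.\<close>
  obtain p where p: "prime p" "p > n0 + 2 + 4 * nat \<bar>a * b * v\<bar>"
    using bigger_prime by blast
  then have "odd p" by (intro prime_odd_nat) auto
  then obtain m where m: "p = 2 * m + 1" by (elim oddE)
  have "fact (2 * m) \<le> K * x ^ (2 * m)" using p m by (intro main) auto
  moreover have "K * (inverse (fact (2 * m)) * x ^ (2 * m)) < 1" using p m by (intro n0) auto
  ultimately show False by (simp add: field_simps)
qed

end
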